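(* For any fixed finite $L$, there exist a constant $C\ge 1$ and an algorithm that takes as input $m,n\in\mathbb{N}$ and a zero-set $\mathcal{Z}$ with $\mathcal{Z}\subseteq R_{a,b}\subseteq R_{n,m}$, returns a number in the interval $[\gamma^L,C\gamma^L]$, where $\gamma^L=\gamma^L(\mathcal{Z},m,n)$, and runs in time that is polynomial in $ab$.
   Context: $\mathbb{Z}_+=\{0,1,2,\dots\}$, $\mathbb{N}=\{1,2,\dots\}$, $[0,c]=\{0,1,\dots,c\}$, and, for integers $a,b\ge1$, $R_{a,b}=[0,a-1]\times[0,b-1]$. A zero-set (Young diagram) is a downward-closed set $\mathcal{Z}\subseteq\mathbb{Z}_+^2$. For $m,n\in\mathbb{N}$, the graph $K_m\Box K_n$ is represented on the vertex set $R_{n,m}=[0,n-1]\times[0,m-1]$, with two vertices adjacent iff they differ in exactly one coordinate. For $v=(j,i)\in R_{n,m}$, the row neighborhood $\mathcal{N}^r(v)$ is the set of all $(j',i)\in R_{n,m}$ with $j'\neq j$, and the column neighborhood $\mathcal{N}^c(v)$ is the set of all $(j,i')\in R_{n,m}$ with $i'\ne i$. Given $\mathcal{Z}$, for $A\subseteq R_{n,m}$ let $\mathcal{T}(A)=A\cup\{v\in R_{n,m}\setminus A\colon (|\mathcal{N}^r(v)\cap A|,|\mathcal{N}^c(v)\cap A|)\notin\mathcal{Z}\}$; $\mathcal{T}^L$ is the $L$-fold iterate, with $\mathcal{T}^0(A)=A$. For $L\in\mathbb{Z}_+$, $\gamma^L(\mathcal{Z},m,n)=\min\{|A|\colon A\subseteq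 R_{n,m},\ \mathcal{T}^L(A)=R_{n,m}\}$. Running time is counted in elementary arithmetic operations and comparisons on integers (unit cost). The constant $C$ and the polynomial may depend on $L$. *)

theory Defs
  imports Complex_Main "HOL-Computational_Algebra.Polynomial"
begin

section \<open>Neighborhood growth on the Hamming rectangle\<close>

definition rect :: "nat \<Rightarrow> nat \<Rightarrow> (nat \<times> nat) set" where
  "rect a b = {0..<a} \<times> {0..<b}"

definition zero_set :: "(nat \<times> nat) set \<Rightarrow> bool" where
  "zero_set Z \<longleftrightarrow> (\<forall>u v u' v'. (u, v) \<in> Z \<longrightarrow> u' \<le> u \<longrightarrow> v' \<le> v \<longrightarrow> (u', v') \<in> Z)"

text \<open>The vertex set of the graph is \<^term>\<open>rect n m\<close>: first coordinates
  run below \<open>n\<close>, second coordinates below \<open>m\<close>.\<close>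

definition row_nbhd :: "nat \<Rightarrow> nat \<Rightarrow> nat \<times> nat \<Rightarrow> (nat \<times> nat) set" where
  "row_nbhd m n v = {w \<in> rect n m. snd w = snd v \<and> fst w \<noteq> fst v}"

definition col_nbhd :: "nat \<Rightarrow> nat \<Rightarrow> nat \<times> nat \<Rightarrow> (nat \<times> nat) set" where
  "col_nbhd m n v = {w \<in> rect n m. fst w = fst v \<and> snd w \<noteq> snd v}"

definition growth :: "(nat \<times> nat) set \<Rightarrow> nat \<Rightarrow> nat \<Rightarrow> (nat \<times> nat) set \<Rightarrow> (nat \<times> nat) set" where
  "growth Z m n A = A \<union>
     {v \<in> rect n m - A. (card (row_nbhd m n v \<inter> A), card (col_nbhd m n v \<inter> A)) \<notin> Z}"

definition gamma :: "nat \<Rightarrow> (nat \<times> nat) set \<Rightarrow> nat \<Rightarrow> nat \<Rightarrow> nat" where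
  "gamma L Z m n = Min {card A | A. A \<subseteq> rect n m \<and> (growth Z m n ^^ L) A = rect n m}"

text \<open>The minimum is over a finite nonempty set, and hence is attained.\<close>

lemma gamma_set_finite:
  "finite {card A | A. A \<subseteq> rect n m \<and> (growth Z m n ^^ L) A = rect n m}"
proof -
  have "finite (rect n m)" by (simp add: rect_def)
  then have "finite (card ` Pow (rect n m))" by simp
  then show ?thesis by (rule rev_finite_subset) auto
qed

lemma gamma_set_nonempty:
  "{card A | A. A \<subseteq> rect n m \<and> (growth Z m n ^^ L) A = rect n m} \<noteq> {}"
proof -
  have "growth Z m n (rect n m) = rect n m" by (simp add: growth_def)
  then have "(growth Z m n ^^ L) (rect n m) = rect n m" by (induction L) auto
  then show ?thesis by blast
qed


section \<open>Unit-cost integer programs\<close>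

text \<open>A random access machine over the integers with structured control flow.
  Memory consists of named arrays of unbounded integers, indexed by computed integer
  addresses; a scalar is the entry of an array at index 0. The arithmetic operations are
  addition, subtraction and multiplication. A division instruction is deliberately
  omitted, as it makes unit-cost machines unreasonably powerful.\<close>

type_synonym memory = "string \<Rightarrow> int \<Rightarrow> int"

datatype expr =
    Const int
  | Read string expr
  | Add expr expr
  | Sub expr expr
  | Mul expr expr

datatype test =
    Less expr expr
  | LessEq expr expr
  | Equal expr expr

datatype prog =
    Skip
  | Assign string expr expr
  | Seq prog prog
  | Branch test prog prog
  | While test prog

fun eval_expr :: "expr \<Rightarrow> memory \<Rightarrow> int" where
  "eval_expr (Const c) s = c"
| "eval_expr (Read x e) s = s x (eval_expr e s)"
| "eval_expr (Add e f) s = eval_expr e s + eval_expr f s"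
| "eval_expr (Sub e f) s = eval_expr e s - eval_expr f s"
| "eval_expr (Mul e f) s = eval_expr e s * eval_expr f s"

fun eval_test :: "test \<Rightarrow> memory \<Rightarrow> bool" where
  "eval_test (Less e f) s \<longleftrightarrow> eval_expr e s < eval_expr f s"
| "eval_test (LessEq e f) s \<longleftrightarrow> eval_expr e s \<le> eval_expr f s"
| "eval_test (Equal e f) s \<longleftrightarrow> eval_expr e s = eval_expr f s"

text \<open>Every constant, memory access, arithmetic operation and comparison costs one unit.\<close>

fun expr_cost :: "expr \<Rightarrow> nat" where
  "expr_cost (Const c) = 1"
| "expr_cost (Read x e) = expr_cost e + 1"
| "expr_cost (Add e f) = expr_cost e + expr_cost f + 1"
| "expr_cost (Sub e f) = expr_cost e + expr_cost f + 1"
| "expr_cost (Mul e f) = expr_cost e + expr_cost f + 1"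

fun test_cost :: "test \<Rightarrow> nat" where
  "test_cost (Less e f) = expr_cost e + expr_cost f + 1"
| "test_cost (LessEq e f) = expr_cost e + expr_cost f + 1"
| "test_cost (Equal e f) = expr_cost e + expr_cost f + 1"

text \<open>\<open>exec p s t s'\<close>: started in memory \<open>s\<close>, the program \<open>p\<close> halts after time \<open>t\<close>
  in memory \<open>s'\<close>.\<close>

inductive exec :: "prog \<Rightarrow> memory \<Rightarrow> nat \<Rightarrow> memory \<Rightarrow> bool" where
  Skip: "exec Skip s 1 s"
| Assign: "exec (Assign x e f) s (expr_cost e + expr_cost f + 1)
    (s(x := (s x)(eval_expr e s := eval_expr f s)))"
| Seq: "exec p s t s' \<Longrightarrow> exec q s' t' s'' \<Longrightarrow> exec (Seq p q) s (t + t') s''"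
| BranchTrue: "eval_test b s \<Longrightarrow> exec p s t s' \<Longrightarrow>
    exec (Branch b p q) s (test_cost b + t) s'"
| BranchFalse: "\<not> eval_test b s \<Longrightarrow> exec q s t s' \<Longrightarrow>
    exec (Branch b p q) s (test_cost b + t) s'"
| WhileFalse: "\<not> eval_test b s \<Longrightarrow> exec (While b p) s (test_cost b) s"
| WhileTrue: "eval_test b s \<Longrightarrow> exec p s t s' \<Longrightarrow> exec (While b p) s' t' s'' \<Longrightarrow>
    exec (While b p) s (test_cost b + t + t') s''"

inductive_cases SkipE: "exec Skip s t s'"
inductive_cases AssignE: "exec (Assign x e f) s t s'"
inductive_cases SeqE: "exec (Seq p q) s t s'"
inductive_cases BranchE: "exec (Branch b p q) s t s'"
inductive_cases WhileE: "exec (While b p) s t s'"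

lemma exec_deterministic:
  "exec p s t s' \<Longrightarrow> exec p s u r \<Longrightarrow> u = t \<and> r = s'"
proof (induction arbitrary: u r rule: exec.induct)
  case (Skip s)
  then show ?case by (auto elim: SkipE)
next
  case (Assign x e f s)
  then show ?case by (auto elim: AssignE)
next
  case (Seq p s t s' q t' s'')
  from Seq.prems show ?case by (rule SeqE) (use Seq.IH in blast)
next
  case (BranchTrue b s p t s' q)
  from BranchTrue.prems show ?case by (rule BranchE) (use BranchTrue in blast)+
next
  case (BranchFalse b s q t s' p)
  from BranchFalse.prems show ?case by (rule BranchE) (use BranchFalse in blast)+
next
  case (WhileFalse b s p)
  from WhileFalse.prems show ?case by (rule WhileE) (use WhileFalse in blast)+
next
  case (WhileTrue b s p t s' t' s'')
  from WhileTrue.prems show ?case by (rule WhileE) (use WhileTrue in blast)+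
qed

text \<open>The scalars \<open>m, n, a, b\<close> are stored under their names. The zero-set
  \<open>Z \<subseteq> rect a b\<close> is given by its \<open>a \<times> b\<close> table of membership bits: for \<open>u < a\<close> and
  \<open>v < b\<close>, entry \<open>u * b + v\<close> of the array \<open>''Z''\<close> is 1 iff \<open>(u, v) \<in> Z\<close>.
  All other memory is 0. The result is left in the scalar \<open>out\<close>.\<close>

definition initial_memory :: "nat \<Rightarrow> nat \<Rightarrow> nat \<Rightarrow> nat \<Rightarrow> (nat \<times> nat) set \<Rightarrow> memory" where
  "initial_memory m n a b Z x k =
    (if x = ''m'' \<and> k = 0 then int m
     else if x = ''n'' \<and> k = 0 then int n
     else if x = ''a'' \<and> k = 0 then int a
     else if x = ''b'' \<and> k = 0 then int b
     else if x = ''Z'' \<and> (\<exists>u<a. \<exists>v<b. k = int (u * b + v) \<and> (u, v) \<in> Z) then 1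
     else 0)"

definition returned :: "memory \<Rightarrow> int" where
  "returned s = s ''out'' 0"

end

theory Submission
  imports Defs
begin

text \<open>
  Let \<open>h u\<close> be the height of \<open>Z\<close> above \<open>u\<close>. If a set fills \<open>u\<close> columns and \<open>h u\<close> rows of a
  \<open>p \<times> q\<close> rectangle, then one more step fills the rectangle. So an upper bound for the cost of
  filling it in \<open>k + 1\<close> steps is the smaller of its cost in \<open>k\<close> steps and the minimum over
  \<open>u \<le> a\<close> of the costs of \<open>u \<times> q\<close> and \<open>p \<times> h u\<close> in \<open>k\<close> steps. This recursion is sharp up to the
  factor \<open>4 ^ k\<close>, even for the weaker aim of having \<open>p\<close> points in each of some \<open>q\<close> rows: let \<open>u\<close> be
  the median of the row counts one step earlier. Half of the rows have at least \<open>u\<close> points, and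
  either at least \<open>p / 2\<close> columns have at least \<open>h u\<close> points, or else half of the rows already
  had at least \<open>p / 2\<close> points each. For fixed \<open>k\<close> the unrolled recursion takes polynomial time,
  as \<open>u\<close> ranges over \<open>a + 1\<close> values and \<open>h u\<close> is a sum of \<open>b\<close> table entries.
\<close>

section \<open>The recursive cost\<close>

text \<open>On a zero-set inside a finite rectangle this is the least \<open>v\<close> with
  \<open>(u, v) \<notin> Z\<close>. As a count it can be computed by adding up table bits.\<close>

definition height :: "(nat \<times> nat) set \<Rightarrow> nat \<Rightarrow> nat" where
  "height Z u = card {v. (u, v) \<in> Z}"

text \<open>Here \<open>p\<close> counts columns and \<open>q\<close> counts rows. For the heights
  of a subset of \<open>rect a b\<close> the range \<open>u \<le> a\<close> suffices, since the
  height already vanishes at \<open>a\<close>.\<close>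

primrec cost :: "(nat \<Rightarrow> nat) \<Rightarrow> nat \<Rightarrow> nat \<Rightarrow> nat \<Rightarrow> nat \<Rightarrow> nat" where
  "cost h a 0 p q = p * q"
| "cost h a (Suc k) p q =
    Min (insert (cost h a k p q) ((\<lambda>u. cost h a k u q + cost h a k p (h u)) ` {..<Suc a}))"

lemma cost_Suc_le: "cost h a (Suc k) p q \<le> cost h a k p q"
  by simp

lemma cost_Suc_le_split:
  assumes "u \<le> a"
  shows "cost h a (Suc k) p q \<le> cost h a k u q + cost h a k p (h u)"
proof -
  have "cost h a k u q + cost h a k p (h u) \<in>
      (\<lambda>u. cost h a k u q + cost h a k p (h u)) ` {..<Suc a}"
    using assms by (intro imageI) simp
  then show ?thesis
    by (simp del: lessThan_Suc image_eqI)
qed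

lemma cost_Suc_cases:
  obtains "cost h a (Suc k) p q = cost h a k p q"
  | u where "u \<le> a" "cost h a (Suc k) p q = cost h a k u q + cost h a k p (h u)"
proof -
  have "cost h a (Suc k) p q \<in>
      insert (cost h a k p q) ((\<lambda>u. cost h a k u q + cost h a k p (h u)) ` {..<Suc a})"
    unfolding cost.simps by (rule Min_in) auto
  then show ?thesis
    using that by (auto simp del: cost.simps simp: less_Suc_eq_le)
qed

lemma cost_mono: "p \<le> p' \<Longrightarrow> q \<le> q' \<Longrightarrow> cost h a k p q \<le> cost h a k p' q'"
proof (induction k arbitrary: p p' q q')
  case 0
  then show ?case by (simp add: mult_le_mono)
next
  case (Suc k)
  show ?case
  proof (cases rule: cost_Suc_cases[of h a k p' q'])
    case 1
    then show ?thesis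
      using Suc cost_Suc_le[of h a k p q] by (metis order_trans)
  next
    case (2 u)
    have "cost h a k u q \<le> cost h a k u q'" "cost h a k p (h u) \<le> cost h a k p' (h u)"
      using Suc by auto
    then show ?thesis
      using cost_Suc_le_split[OF 2(1), of h k p q] 2(2) by linarith
  qed
qed

text \<open>The \<open>u\<close> that is optimal for \<open>p'\<close> also serves \<open>p\<close>:
  the summand for \<open>u\<close> columns does not involve the first argument, and the other one at
  most doubles by induction. So the factor stays 2 at every depth.\<close>

lemma cost_halve_fst: "p \<le> 2 * p' \<Longrightarrow> cost h a k p q \<le> 2 * cost h a k p' q"
proof (induction k arbitrary: p p' q)
  case 0
  then show ?case by (metis cost.simps(1) mult.assoc mult_le_mono1)
next
  case (Suc k)
  show ?case
  proof (cases rule: cost_Suc_cases[of h a k p' q])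
    case 1
    then show ?thesis
      using Suc cost_Suc_le[of h a k p q] by (metis order_trans)
  next
    case (2 u)
    have "cost h a k p (h u) \<le> 2 * cost h a k p' (h u)"
      using Suc by auto
    then show ?thesis
      using cost_Suc_le_split[OF 2(1), of h k p q] 2(2) by linarith
  qed
qed

lemma cost_halve_snd: "q \<le> 2 * q' \<Longrightarrow> cost h a k p q \<le> 2 * cost h a k p q'"
proof (induction k arbitrary: p q q')
  case 0
  then have "p * q \<le> p * (2 * q')" by (rule mult_le_mono2)
  then show ?case by (simp add: mult.left_commute)
next
  case (Suc k)
  show ?case
  proof (cases rule: cost_Suc_cases[of h a k p q'])
    case 1
    then show ?thesis
      using Suc cost_Suc_le[of h a k p q] by (metis order_trans)
  next
    case (2 u)
    have "cost h a k u q \<le> 2 * cost h a k u q'"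
      using Suc by auto
    then show ?thesis
      using cost_Suc_le_split[OF 2(1), of h k p q] 2(2) by linarith
  qed
qed

section \<open>Zero-sets as regions below their heights\<close>

lemma finite_rect: "finite (rect a b)"
  by (simp add: rect_def)

text \<open>Downward closure makes the fibre of \<open>Z\<close> over \<open>u\<close> an initial
  segment, which is determined by its size.\<close>

lemma mem_zero_set_iff:
  assumes "zero_set Z" "Z \<subseteq> rect a b"
  shows "(u, v) \<in> Z \<longleftrightarrow> v < height Z u"
proof -
  have fin: "finite {v. (u, v) \<in> Z}"
    by (rule finite_subset[of _ "{..<b}"]) (use assms in \<open>auto simp: rect_def\<close>)
  have down: "(u, v') \<in> Z" if "(u, v) \<in> Z" "v' \<le> v" for v v'
    using assms(1) that unfolding zero_set_def by blast
  show ?thesis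
  proof
    assume "(u, v) \<in> Z"
    then have "{..v} \<subseteq> {v. (u, v) \<in> Z}" using down by auto
    then have "card {..v} \<le> height Z u"
      unfolding height_def by (rule card_mono[OF fin])
    then show "v < height Z u" by simp
  next
    assume *: "v < height Z u"
    show "(u, v) \<in> Z"
    proof (rule ccontr)
      assume "(u, v) \<notin> Z"
      then have "{v. (u, v) \<in> Z} \<subseteq> {..<v}"
        using down by (metis lessThan_iff mem_Collect_eq not_less subsetI)
      then have "height Z u \<le> card {..<v}"
        unfolding height_def by (intro card_mono) auto
      then show False using * by simp
    qed
  qed
qed

lemma height_le:
  assumes "Z \<subseteq> rect a b"
  shows "height Z u \<le> b"
proof -
  have "height Z u \<le> card {..<b}"
    unfolding height_def
    by (rule card_mono) (use assms in \<open>auto simp: rect_def\<close>)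
  then show ?thesis by simp
qed

section \<open>Upper bound\<close>

lemma growth_subset: "A \<subseteq> rect n m \<Longrightarrow> growth Z m n A \<subseteq> rect n m"
  by (auto simp: growth_def)

lemma funpow_growth_subset: "A \<subseteq> rect n m \<Longrightarrow> (growth Z m n ^^ k) A \<subseteq> rect n m"
  by (induction k) (auto dest: growth_subset[THEN subsetD])

lemma growth_mono:
  assumes "zero_set Z" "A \<subseteq> B"
  shows "growth Z m n A \<subseteq> growth Z m n B"
proof
  fix v assume v: "v \<in> growth Z m n A"
  have fin: "finite (row_nbhd m n v)" "finite (col_nbhd m n v)"
    by (auto simp: row_nbhd_def col_nbhd_def finite_rect)
  have "card (row_nbhd m n v \<inter> A) \<le> card (row_nbhd m n v \<inter> B)"
    "card (col_nbhd m n v \<inter> A) \<le> card (col_nbhd m n v \<inter> B)"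
    using fin assms(2) by (auto intro!: card_mono)
  then show "v \<in> growth Z m n B"
    using v assms unfolding growth_def zero_set_def by blast
qed

lemma funpow_growth_mono:
  "zero_set Z \<Longrightarrow> A \<subseteq> B \<Longrightarrow> (growth Z m n ^^ k) A \<subseteq> (growth Z m n ^^ k) B"
  by (induction k) (auto dest: growth_mono[THEN subsetD])

text \<open>Unite a seed for \<open>rect u q\<close> with a seed for
  \<open>rect p (height Z u)\<close>. After \<open>k\<close> steps every vertex still missing sees
  \<open>u\<close> occupied vertices in its row and \<open>height Z u\<close> in its column, and
  this pair lies outside \<open>Z\<close>.\<close>

lemma fill_rect:
  assumes Z: "zero_set Z" "Z \<subseteq> rect a b" and "a \<le> n" "b \<le> m"
  shows "p \<le> n \<Longrightarrow> q \<le> m \<Longrightarrow> \<exists>A \<subseteq> rect n m. card A \<le> cost (height Z) a k p q \<and>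
    rect p q \<subseteq> (growth Z m n ^^ k) A"
proof (induction k arbitrary: p q)
  case 0
  then have "rect p q \<subseteq> rect n m" by (auto simp: rect_def)
  moreover have "card (rect p q) = p * q" by (simp add: rect_def)
  ultimately show ?case by (intro exI[of _ "rect p q"]) simp
next
  case (Suc k)
  show ?case
  proof (cases rule: cost_Suc_cases[of "height Z" a k p q])
    case 1
    from Suc.IH[OF Suc.prems] obtain A where A: "A \<subseteq> rect n m" "card A \<le> cost (height Z) a k p q"
      "rect p q \<subseteq> (growth Z m n ^^ k) A"
      by blast
    have "rect p q \<subseteq> (growth Z m n ^^ Suc k) A"
      using A(3) by (auto simp: growth_def)
    with A(1,2) show ?thesis unfolding 1 by blast
  next
    case (2 u)
    let ?v = "height Z u"
    \<comment> \<open>Both rectangles fit into the vertex set, because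
      \<open>u \<le> a \<le> n\<close> and \<open>height Z u \<le> b \<le> m\<close>.\<close>
    have "u \<le> n" "?v \<le> m"
      using 2 assms height_le[OF Z(2), of u] by auto
    from Suc.IH[OF \<open>u \<le> n\<close> Suc.prems(2)] obtain A1 where
      A1: "A1 \<subseteq> rect n m" "card A1 \<le> cost (height Z) a k u q"
        "rect u q \<subseteq> (growth Z m n ^^ k) A1"
      by blast
    from Suc.IH[OF Suc.prems(1) \<open>?v \<le> m\<close>] obtain A2 where
      A2: "A2 \<subseteq> rect n m" "card A2 \<le> cost (height Z) a k p ?v"
        "rect p ?v \<subseteq> (growth Z m n ^^ k) A2"
      by blast
    define B where "B = (growth Z m n ^^ k) (A1 \<union> A2)"
    have B: "rect u q \<subseteq> B" "rect p ?v \<subseteq> B"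
      using A1(3) A2(3) funpow_growth_mono[OF Z(1), of A1 "A1 \<union> A2"]
        funpow_growth_mono[OF Z(1), of A2 "A1 \<union> A2"] unfolding B_def by blast+
    have "rect p q \<subseteq> growth Z m n B"
    proof
      fix w assume w: "w \<in> rect p q"
      obtain j i where ji: "w = (j, i)" by fastforce
      show "w \<in> growth Z m n B"
      proof (cases "w \<in> B")
        case True
        then show ?thesis by (simp add: growth_def)
      next
        case False
        have "(\<lambda>j'. (j', i)) ` {..<u} \<subseteq> row_nbhd m n w \<inter> B"
        proof (rule image_subsetI)
          fix j' assume "j' \<in> {..<u}"
          then have *: "(j', i) \<in> rect u q" using w ji by (auto simp: rect_def)
          then have "(j', i) \<in> B" using B by blast
          \<comment> \<open>Since \<open>(j, i)\<close> itself is missing from \<open>B\<close>,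
            none of the \<open>u\<close> occupied vertices is lost by excluding it from its own
            neighborhood.\<close>
          moreover from this have "j' \<noteq> j" using False ji by blast
          ultimately show "(j', i) \<in> row_nbhd m n w \<inter> B"
            using * \<open>u \<le> n\<close> \<open>q \<le> m\<close> ji by (auto simp: row_nbhd_def rect_def)
        qed
        then have "card ((\<lambda>j'. (j', i)) ` {..<u}) \<le> card (row_nbhd m n w \<inter> B)"
          by (rule card_mono[rotated]) (simp add: row_nbhd_def finite_rect)
        then have r: "u \<le> card (row_nbhd m n w \<inter> B)"
          by (simp add: card_image inj_on_def)
        have "Pair j ` {..<?v} \<subseteq> col_nbhd m n w \<inter> B"
        proof (rule image_subsetI)
          fix i' assume "i' \<in> {..<?v}"
          then have *: "(j, i') \<in> rect p ?v" using w ji by (auto simp: rect_def)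
          then have "(j, i') \<in> B" using B by blast
          moreover from this have "i' \<noteq> i" using False ji by blast
          ultimately show "(j, i') \<in> col_nbhd m n w \<inter> B"
            using * \<open>?v \<le> m\<close> \<open>p \<le> n\<close> ji by (auto simp: col_nbhd_def rect_def)
        qed
        then have "card (Pair j ` {..<?v}) \<le> card (col_nbhd m n w \<inter> B)"
          by (rule card_mono[rotated]) (simp add: col_nbhd_def finite_rect)
        then have c: "?v \<le> card (col_nbhd m n w \<inter> B)"
          by (simp add: card_image inj_on_def)
        have "(u, ?v) \<notin> Z" by (simp add: mem_zero_set_iff[OF Z])
        then have "(card (row_nbhd m n w \<inter> B), card (col_nbhd m n w \<inter> B)) \<notin> Z"
          using Z(1) r c unfolding zero_set_def by blast
        moreover have "w \<in> rect n m"
          using w Suc.prems by (auto simp: rect_def)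
        ultimately show ?thesis using False by (simp add: growth_def)
      qed
    qed
    moreover have "card (A1 \<union> A2) \<le> cost (height Z) a (Suc k) p q"
      using card_Un_le[of A1 A2] A1(2) A2(2) 2(2) by linarith
    ultimately show ?thesis
      using A1(1) A2(1) unfolding B_def
      by (intro exI[of _ "A1 \<union> A2"]) (simp del: cost.simps)
  qed
qed

lemma gamma_le_cost:
  assumes "zero_set Z" "Z \<subseteq> rect a b" "a \<le> n" "b \<le> m"
  shows "gamma L Z m n \<le> cost (height Z) a L n m"
proof -
  obtain A where A: "A \<subseteq> rect n m" "card A \<le> cost (height Z) a L n m"
    "rect n m \<subseteq> (growth Z m n ^^ L) A"
    using fill_rect[OF assms order_refl order_refl] by blast
  then have "(growth Z m n ^^ L) A = rect n m"
    using funpow_growth_subset by blast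
  then have "gamma L Z m n \<le> card A"
    unfolding gamma_def using A(1) by (intro Min_le gamma_set_finite) blast
  with A(2) show ?thesis by linarith
qed

section \<open>Lower bound\<close>

definition row_count :: "(nat \<times> nat) set \<Rightarrow> nat \<Rightarrow> nat" where
  "row_count B i = card {j. (j, i) \<in> B}"

text \<open>Columns are treated as rows of the converse relation.\<close>

definition rich_rows :: "nat \<Rightarrow> (nat \<times> nat) set \<Rightarrow> nat \<Rightarrow> nat \<Rightarrow> bool" where
  "rich_rows m B u q \<longleftrightarrow> q \<le> card {i. i < m \<and> u \<le> row_count B i}"

text \<open>Take the median \<open>u'\<close> of the counts in \<open>B\<close> over the rich rows
  of \<open>B'\<close>. If many columns reach the height at \<open>u'\<close>, the split follows. If
  few do, rows below the median gained points only in these columns and were nearly as rich before.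
  A pair outside \<open>Z\<close> with both entries bounded allows reuse with rows and columns
  swapped.\<close>

lemma rich_rows_step:
  assumes Z: "zero_set Z" "Z \<subseteq> rect a b"
    and sub: "B \<subseteq> rect n m" "B' \<subseteq> rect n m"
    and step: "\<forall>j i. (j, i) \<in> B' \<longrightarrow> (j, i) \<in> B \<or> (row_count B i, row_count (B\<inverse>) j) \<notin> Z"
    and rich: "rich_rows m B' u q"
  shows "(\<exists>u' v' p1 q1. (u', v') \<notin> Z \<and> u' \<le> a \<and> v' \<le> b \<and> rich_rows m B u' q1 \<and>
      rich_rows n (B\<inverse>) v' p1 \<and> q \<le> 2 * q1 \<and> u \<le> 2 * p1) \<or>
    (\<exists>u1 q1. rich_rows m B u1 q1 \<and> u \<le> 2 * u1 \<and> q \<le> 2 * q1)" (is "?split \<or> ?keep")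
proof (cases "q = 0")
  case True
  \<comment> \<open>Without a rich row nothing bounds \<open>u\<close> by \<open>n\<close>, so this
    case is settled apart.\<close>
  then have ?keep by (intro exI[of _ u] exI[of _ 0]) (simp add: rich_rows_def)
  then show ?thesis ..
next
  case False
  define Q where "Q = {i. i < m \<and> u \<le> row_count B' i}"
  have finQ: "finite Q" and Q: "q \<le> card Q"
    using rich by (auto simp: Q_def rich_rows_def)
  have finB: "finite {j. (j, i) \<in> B}" for i
    by (rule finite_subset[of _ "{..<n}"]) (use sub in \<open>auto simp: rect_def\<close>)
  have "u \<le> n"
  proof -
    obtain i where i: "i \<in> Q" using False Q by fastforce
    have "{j. (j, i) \<in> B'} \<subseteq> {..<n}" using sub by (auto simp: rect_def)
    then have "row_count B' i \<le> card {..<n}" unfolding row_count_def by (rule card_mono[rotated]) simp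
    then show ?thesis using i by (simp add: Q_def)
  qed
  let ?P = "\<lambda>x. x \<le> a \<and> card Q \<le> 2 * card {i \<in> Q. x \<le> row_count B i}"
  \<comment> \<open>the median of the row counts over \<open>Q\<close>, truncated at \<open>a\<close>\<close>
  define u' where "u' = (GREATEST x. ?P x)"
  have "?P 0" by simp
  then have u': "?P u'"
    unfolding u'_def by (rule GreatestI_nat[where b = a]) simp
  have max: "x \<le> u'" if "?P x" for x
    unfolding u'_def by (rule Greatest_le_nat[where b = a and P = ?P]) (use that in auto)
  let ?v = "height Z u'"
  define J where "J = {j. j < n \<and> ?v \<le> row_count (B\<inverse>) j}"
  define q1 where "q1 = card {i \<in> Q. u' \<le> row_count B i}"
  have r1: "rich_rows m B u' q1"
    unfolding rich_rows_def q1_def by (rule card_mono) (auto simp: Q_def)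
  show ?thesis
  proof (cases "u \<le> 2 * card J")
    case True
    have "rich_rows n (B\<inverse>) ?v (card J)" by (simp add: rich_rows_def J_def)
    moreover have "(u', ?v) \<notin> Z" by (simp add: mem_zero_set_iff[OF Z])
    moreover have "q \<le> 2 * q1" using u' Q by (simp add: q1_def)
    ultimately have ?split
      using True r1 u' height_le[OF Z(2), of u'] by blast
    then show ?thesis ..
  next
    case False
    \<comment> \<open>At \<open>u' = a\<close> the height is 0, so every column would lie in
      \<open>J\<close>, against \<open>2 * card J < u \<le> n\<close>.\<close>
    have "u' < a"
    proof (rule ccontr)
      assume "\<not> u' < a"
      then have "{v. (u', v) \<in> Z} = {}" using Z(2) by (auto simp: rect_def)
      then have "?v = 0" by (simp add: height_def)
      then have "card J = n" by (simp add: J_def)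
      with False \<open>u \<le> n\<close> show False by simp
    qed
    \<comment> \<open>Maximality of \<open>u'\<close> leaves more than half of \<open>Q\<close> with
      counts of at most \<open>u'\<close>.\<close>
    define Q' where "Q' = {i \<in> Q. row_count B i \<le> u'}"
    have "\<not> ?P (Suc u')" using max[of "Suc u'"] by auto
    then have "2 * card {i \<in> Q. Suc u' \<le> row_count B i} < card Q"
      using \<open>u' < a\<close> by auto
    moreover have "card Q = card Q' + card {i \<in> Q. Suc u' \<le> row_count B i}"
    proof -
      have "Q = Q' \<union> {i \<in> Q. Suc u' \<le> row_count B i}" by (auto simp: Q'_def)
      moreover have "card (Q' \<union> {i \<in> Q. Suc u' \<le> row_count B i}) =
          card Q' + card {i \<in> Q. Suc u' \<le> row_count B i}"
        by (rule card_Un_disjoint) (auto simp: Q'_def finQ)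
      ultimately show ?thesis by metis
    qed
    ultimately have Q': "q \<le> 2 * card Q'" using Q by linarith
    \<comment> \<open>A point gained in row \<open>i\<close> lies in a column of \<open>J\<close>:
      the row count is at most \<open>u'\<close>, so by downward closure the column count reaches
      the height at \<open>u'\<close>. Hence at most \<open>card J\<close> points of the row are
      new.\<close>
    have "u - card J \<le> row_count B i" if i: "i \<in> Q'" for i
    proof -
      have "{j. (j, i) \<in> B'} \<subseteq> {j. (j, i) \<in> B} \<union> J"
      proof
        fix j assume "j \<in> {j. (j, i) \<in> B'}"
        then have j: "(j, i) \<in> B'" by simp
        show "j \<in> {j. (j, i) \<in> B} \<union> J"
        proof (cases "(j, i) \<in> B")
          case False
          then have "(row_count B i, row_count (B\<inverse>) j) \<notin> Z" using step j by blast
          then have "(u', row_count (B\<inverse>) j) \<notin> Z"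
            using i Z(1) unfolding Q'_def zero_set_def by blast
          then have "?v \<le> row_count (B\<inverse>) j" using mem_zero_set_iff[OF Z] not_less by blast
          then show ?thesis using j sub by (auto simp: J_def rect_def)
        qed simp
      qed
      then have "row_count B' i \<le> card ({j. (j, i) \<in> B} \<union> J)"
        unfolding row_count_def by (rule card_mono[rotated]) (simp add: finB J_def)
      also have "\<dots> \<le> row_count B i + card J"
        unfolding row_count_def by (rule card_Un_le)
      finally show ?thesis using i unfolding Q'_def Q_def by fastforce
    qed
    then have "rich_rows m B (u - card J) (card Q')"
      unfolding rich_rows_def by (intro card_mono) (auto simp: Q'_def Q_def)
    moreover have "u \<le> 2 * (u - card J)" using False by linarith
    ultimately have ?keep using Q' by blast
    then show ?thesis ..
  qed
qed

text \<open>For a vertex outside \<open>B\<close>, leaving out the vertex itself changes no count.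
  Full row and column counts replace neighborhoods, which makes the condition symmetric under
  transposition.\<close>

lemma growth_step:
  assumes "(j, i) \<in> growth Z m n B" "B \<subseteq> rect n m"
  shows "(j, i) \<in> B \<or> (row_count B i, row_count (B\<inverse>) j) \<notin> Z"
proof (cases "(j, i) \<in> B")
  case False
  have "row_nbhd m n (j, i) \<inter> B = (\<lambda>j'. (j', i)) ` {j'. (j', i) \<in> B}"
    using assms(2) False by (auto simp: row_nbhd_def)
  then have "card (row_nbhd m n (j, i) \<inter> B) = row_count B i"
    by (simp add: row_count_def card_image inj_on_def)
  moreover have "col_nbhd m n (j, i) \<inter> B = Pair j ` {i'. (j, i') \<in> B}"
    using assms(2) False by (auto simp: col_nbhd_def)
  then have "card (col_nbhd m n (j, i) \<inter> B) = row_count (B\<inverse>) j"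
    by (simp add: row_count_def card_image inj_on_def)
  ultimately show ?thesis using assms(1) False by (simp add: growth_def)
qed simp

text \<open>\<open>B\<close> is the disjoint union of its rows. This is the lower bound at time
  0.\<close>

lemma rich_rows_le_card:
  assumes "B \<subseteq> rect n m" "rich_rows m B u q"
  shows "u * q \<le> card B"
proof -
  let ?Q = "{i. i < m \<and> u \<le> row_count B i}"
  have fin: "finite {j. (j, i) \<in> B}" for i
    by (rule finite_subset[of _ "{..<n}"]) (use assms in \<open>auto simp: rect_def\<close>)
  have "u * q \<le> (\<Sum>i\<in>?Q. u)"
    using assms(2) by (simp add: rich_rows_def mult.commute)
  also have "\<dots> \<le> (\<Sum>i\<in>?Q. row_count B i)" by (rule sum_mono) simp
  also have "\<dots> = card (SIGMA i:?Q. {j. (j, i) \<in> B})"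
    unfolding row_count_def by (simp add: fin)
  also have "\<dots> \<le> card (B\<inverse>)"
    by (rule card_mono) (auto intro: finite_subset[OF assms(1) finite_rect])
  finally show ?thesis by simp
qed

lemma zero_set_converse: "zero_set Z \<Longrightarrow> zero_set (Z\<inverse>)"
  unfolding zero_set_def by blast

lemma converse_subset_rect: "B \<subseteq> rect n m \<Longrightarrow> B\<inverse> \<subseteq> rect m n"
  by (auto simp: rect_def)

text \<open>Rows and columns share one induction because a split needs both. Each step loses a
  factor 4: a split doubles two summands of at most \<open>4 ^ k * card A\<close> each, and
  otherwise both arguments are halved at a factor 2 each.\<close>

lemma cost_le_of_rich:
  assumes Z: "zero_set Z" "Z \<subseteq> rect a b" and A: "A \<subseteq> rect n m"
  shows "(\<forall>u q. rich_rows m ((growth Z m n ^^ k) A) u q \<longrightarrow>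
      cost (height Z) a k u q \<le> 4 ^ k * card A) \<and>
    (\<forall>v p. rich_rows n (((growth Z m n ^^ k) A)\<inverse>) v p \<longrightarrow>
      cost (height Z) a k p v \<le> 4 ^ k * card A)"
proof (induction k)
  case 0
  show ?case
    using rich_rows_le_card[OF A] rich_rows_le_card[OF converse_subset_rect[OF A]]
    by (auto simp: mult.commute)
next
  case (Suc k)
  let ?c = "cost (height Z) a"
  define B where "B = (growth Z m n ^^ k) A"
  define B' where "B' = growth Z m n B"
  have B: "B \<subseteq> rect n m" unfolding B_def by (rule funpow_growth_subset[OF A])
  have B': "B' \<subseteq> rect n m" unfolding B'_def by (rule growth_subset[OF B])
  have IHr: "?c k u q \<le> 4 ^ k * card A" if "rich_rows m B u q" for u q
    using Suc that unfolding B_def by blast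
  have IHc: "?c k p v \<le> 4 ^ k * card A" if "rich_rows n (B\<inverse>) v p" for p v
    using Suc that unfolding B_def by blast
  have split: "?c (Suc k) p q \<le> 4 ^ Suc k * card A"
    if "(u', v') \<notin> Z" "u' \<le> a" "rich_rows m B u' q1" "rich_rows n (B\<inverse>) v' p1"
      "q \<le> 2 * q1" "p \<le> 2 * p1" for p q u' v' p1 q1
  proof -
    \<comment> \<open>The pair need not be on the boundary of \<open>Z\<close>; its second entry is
      at least the height, and \<open>cost\<close> is monotone.\<close>
    have "height Z u' \<le> v'" using that(1) mem_zero_set_iff[OF Z] not_less by blast
    then have "?c (Suc k) p q \<le> ?c k u' q + ?c k p v'"
      using cost_Suc_le_split[OF that(2), of "height Z" k p q]
        cost_mono[of p p "height Z u'" v' "height Z" a k] by linarith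
    also have "\<dots> \<le> 2 * ?c k u' q1 + 2 * ?c k p1 v'"
      using that by (intro add_mono cost_halve_fst cost_halve_snd)
    finally show ?thesis using IHr[OF that(3)] IHc[OF that(4)] by simp
  qed
  have keep: "?c (Suc k) p q \<le> 4 ^ Suc k * card A"
    if "?c k p1 q1 \<le> 4 ^ k * card A" "p \<le> 2 * p1" "q \<le> 2 * q1" for p q p1 q1
    using cost_Suc_le[of "height Z" a k p q] cost_halve_fst[OF that(2), of "height Z" a k q]
      cost_halve_snd[OF that(3), of "height Z" a k p1] that(1) unfolding power_Suc by linarith
  have "?c (Suc k) u q \<le> 4 ^ Suc k * card A" if "rich_rows m B' u q" for u q
  proof -
    have "\<forall>j i. (j, i) \<in> B' \<longrightarrow> (j, i) \<in> B \<or> (row_count B i, row_count (B\<inverse>) j) \<notin> Z"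
      using growth_step[OF _ B] unfolding B'_def by blast
    from rich_rows_step[OF Z B B' this \<open>rich_rows m B' u q\<close>] show ?thesis
      by (elim disjE exE conjE) (blast intro: split, blast intro: keep IHr)
  qed
  moreover have "?c (Suc k) p v \<le> 4 ^ Suc k * card A" if "rich_rows n (B'\<inverse>) v p" for p v
  proof -
    \<comment> \<open>For columns, \<open>B\<close>, \<open>B'\<close> and \<open>Z\<close> are all
      transposed. The pair obtained is swapped back, so \<open>split\<close> applies
      unchanged.\<close>
    have "\<forall>i j. (i, j) \<in> B'\<inverse> \<longrightarrow>
        (i, j) \<in> B\<inverse> \<or> (row_count (B\<inverse>) j, row_count ((B\<inverse>)\<inverse>) i) \<notin> Z\<inverse>"
      using growth_step[OF _ B] unfolding B'_def converse_converse converse_iff by blast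
    from rich_rows_step[OF zero_set_converse[OF Z(1)] converse_subset_rect[OF Z(2)]
        converse_subset_rect[OF B] converse_subset_rect[OF B'] this \<open>rich_rows n (B'\<inverse>) v p\<close>]
    show ?thesis unfolding converse_converse converse_iff
      by (elim disjE exE conjE) (blast intro: split, blast intro: keep IHc)
  qed
  ultimately show ?case by (simp add: B'_def B_def del: cost.simps power_Suc)
qed

text \<open>An optimal seed ends in the full rectangle, which has \<open>m\<close> rows of
  \<open>n\<close> points each.\<close>

lemma cost_le_gamma:
  assumes Z: "zero_set Z" "Z \<subseteq> rect a b"
  shows "cost (height Z) a L n m \<le> 4 ^ L * gamma L Z m n"
proof -
  have "gamma L Z m n \<in> {card A | A. A \<subseteq> rect n m \<and> (growth Z m n ^^ L) A = rect n m}"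
    unfolding gamma_def by (rule Min_in[OF gamma_set_finite gamma_set_nonempty])
  then obtain A where A: "A \<subseteq> rect n m" "(growth Z m n ^^ L) A = rect n m"
      "card A = gamma L Z m n"
    by auto
  have "{j. (j, i) \<in> rect n m} = {..<n}" if "i < m" for i
    using that by (auto simp: rect_def)
  then have "{i. i < m \<and> n \<le> row_count (rect n m) i} = {..<m}"
    by (auto simp: row_count_def)
  then have "rich_rows m (rect n m) n m" by (simp add: rich_rows_def)
  then show ?thesis using cost_le_of_rich[OF Z A(1), of L] A(2,3) by simp
qed

section \<open>Timed execution\<close>

text \<open>Total correctness with a time bound; only an upper bound on time is kept, so that it may
  be rounded up.\<close>

definition runs :: "prog \<Rightarrow> memory \<Rightarrow> nat \<Rightarrow> (memory \<Rightarrow> bool) \<Rightarrow> bool" where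
  "runs p s T Q \<longleftrightarrow> (\<exists>t s'. exec p s t s' \<and> t \<le> T \<and> Q s')"

lemma runs_weaken:
  "runs p s T Q \<Longrightarrow> T \<le> T' \<Longrightarrow> (\<And>s'. Q s' \<Longrightarrow> Q' s') \<Longrightarrow> runs p s T' Q'"
  unfolding runs_def using order_trans by blast

lemma runs_Skip: "Q s \<Longrightarrow> runs Skip s 1 Q"
  unfolding runs_def using exec.Skip by blast

lemma runs_Assign:
  "Q (s(x := (s x)(eval_expr e s := eval_expr f s))) \<Longrightarrow>
    runs (Assign x e f) s (expr_cost e + expr_cost f + 1) Q"
  unfolding runs_def using exec.Assign by blast

lemma runs_Seq:
  assumes "runs p s T Q" "\<And>s'. Q s' \<Longrightarrow> runs q s' T' R"
  shows "runs (Seq p q) s (T + T') R"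
proof -
  obtain t s' where 1: "exec p s t s'" "t \<le> T" "Q s'"
    using assms(1) unfolding runs_def by blast
  obtain t' s'' where 2: "exec q s' t' s''" "t' \<le> T'" "R s''"
    using assms(2)[OF 1(3)] unfolding runs_def by blast
  from exec.Seq[OF 1(1) 2(1)] add_mono[OF 1(2) 2(2)] 2(3) show ?thesis
    unfolding runs_def by blast
qed

lemma runs_Assign_Seq:
  "eval_expr e s = i \<Longrightarrow> eval_expr f s = w \<Longrightarrow> runs q (s(x := (s x)(i := w))) T Q \<Longrightarrow>
    runs (Seq (Assign x e f) q) s (expr_cost e + expr_cost f + 1 + T) Q"
  by (rule runs_Seq[OF runs_Assign[where Q = "\<lambda>s'. s' = s(x := (s x)(i := w))"]]) simp_all

lemma runs_Branch:
  assumes "eval_test b s \<Longrightarrow> runs p s T Q" "\<not> eval_test b s \<Longrightarrow> runs q s T Q"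
  shows "runs (Branch b p q) s (test_cost b + T) Q"
proof (cases "eval_test b s")
  case True
  with assms(1) obtain t s' where "exec p s t s'" "t \<le> T" "Q s'"
    unfolding runs_def by blast
  then show ?thesis
    unfolding runs_def using exec.BranchTrue[OF True] add_left_mono by blast
next
  case False
  with assms(2) obtain t s' where "exec q s t s'" "t \<le> T" "Q s'"
    unfolding runs_def by blast
  then show ?thesis
    unfolding runs_def using exec.BranchFalse[OF False] add_left_mono by blast
qed

text \<open>The invariant is indexed by the number of completed rounds. Each of the \<open>N\<close>
  rounds pays for a test and the body, and one failing test ends the loop.\<close>

lemma runs_While:
  assumes start: "I 0 s"
    and loop: "\<And>i s. i < N \<Longrightarrow> I i s \<Longrightarrow> eval_test b s \<and> runs p s T (I (Suc i))"
    and stop: "\<And>s. I N s \<Longrightarrow> \<not> eval_test b s"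
  shows "runs (While b p) s (N * (test_cost b + T) + test_cost b) (I N)"
proof -
  have "i \<le> N \<Longrightarrow> I i s \<Longrightarrow>
      runs (While b p) s ((N - i) * (test_cost b + T) + test_cost b) (I N)" for i s
  proof (induction i arbitrary: s rule: inc_induct)
    case base
    then show ?case unfolding runs_def using exec.WhileFalse[OF stop] by fastforce
  next
    case (step i)
    obtain t s' where b: "eval_test b s" and 1: "exec p s t s'" "t \<le> T" "I (Suc i) s'"
      using loop[OF step.hyps(2) step.prems] unfolding runs_def by blast
    obtain t' s'' where 2: "exec (While b p) s' t' s''"
      "t' \<le> (N - Suc i) * (test_cost b + T) + test_cost b" "I N s''"
      using step.IH[OF 1(3)] unfolding runs_def by blast
    have "N - i = Suc (N - Suc i)" using step.hyps by simp
    then have "test_cost b + t + t' \<le> (N - i) * (test_cost b + T) + test_cost b"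
      using 1(2) 2(2) by simp
    then show ?case
      unfolding runs_def using exec.WhileTrue[OF b 1(1) 2(1)] 2(3) by blast
  qed
  from this[of 0] start show ?thesis by simp
qed

section \<open>The program\<close>

abbreviation slot :: "string \<Rightarrow> nat \<Rightarrow> expr" where
  "slot x k \<equiv> Read x (Const (int k))"

abbreviation store :: "string \<Rightarrow> nat \<Rightarrow> expr \<Rightarrow> prog" where
  "store x k e \<equiv> Assign x (Const (int k)) e"

definition height_prog :: "nat \<Rightarrow> prog" where
  "height_prog k =
    Seq (store ''h'' k (Const 0))
    (Seq (store ''v'' k (Const 0))
    (While (Less (slot ''v'' k) (slot ''b'' 0))
      (Seq (store ''h'' k (Add (slot ''h'' k)
        (Read ''Z'' (Add (Mul (slot ''u'' k) (slot ''b'' 0)) (slot ''v'' k)))))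
      (store ''v'' k (Add (slot ''v'' k) (Const 1))))))"

definition call :: "prog \<Rightarrow> nat \<Rightarrow> string \<Rightarrow> string \<Rightarrow> prog" where
  "call c k x y = Seq (store ''p'' k (slot x (Suc k))) (Seq (store ''q'' k (slot y (Suc k))) c)"

text \<open>The first result is saved in frame \<open>Suc k\<close>, because the second call
  overwrites \<open>r\<close> in frame \<open>k\<close>.\<close>

definition loop_body :: "prog \<Rightarrow> nat \<Rightarrow> prog" where
  "loop_body c k =
    Seq (call c k ''u'' ''q'')
    (Seq (store ''t'' (Suc k) (slot ''r'' k))
    (Seq (height_prog (Suc k))
    (Seq (call c k ''p'' ''h'')
    (Seq (Branch (Less (Add (slot ''t'' (Suc k)) (slot ''r'' k)) (slot ''r'' (Suc k)))
      (store ''r'' (Suc k) (Add (slot ''t'' (Suc k)) (slot ''r'' k))) Skip)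
    (store ''u'' (Suc k) (Add (slot ''u'' (Suc k)) (Const 1)))))))"

text \<open>The recursion is unrolled: index \<open>k\<close> of each array is the stack frame at depth \<open>k\<close>,
  with arguments in \<open>p\<close>, \<open>q\<close> and result in \<open>r\<close>.\<close>

primrec cost_prog :: "nat \<Rightarrow> prog" where
  "cost_prog 0 = store ''r'' 0 (Mul (slot ''p'' 0) (slot ''q'' 0))"
| "cost_prog (Suc k) =
    Seq (call (cost_prog k) k ''p'' ''q'')
    (Seq (store ''r'' (Suc k) (slot ''r'' k))
    (Seq (store ''u'' (Suc k) (Const 0))
    (While (LessEq (slot ''u'' (Suc k)) (slot ''a'' 0)) (loop_body (cost_prog k) k))))"

section \<open>Memory layout and frame conditions\<close>

definition input_at :: "memory \<Rightarrow> nat \<Rightarrow> nat \<Rightarrow> (nat \<times> nat) set \<Rightarrow> bool" where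
  "input_at s a b Z \<longleftrightarrow> s ''a'' 0 = int a \<and> s ''b'' 0 = int b \<and>
    (\<forall>u\<le>a. \<forall>v<b. s ''Z'' (int u * int b + int v) = of_bool ((u, v) \<in> Z))"

text \<open>A call at depth \<open>k\<close> may overwrite any frame up to \<open>k\<close> of the
  working arrays. The input and the locals of the caller, at index \<open>Suc k\<close>,
  survive.\<close>

definition preserves :: "nat \<Rightarrow> memory \<Rightarrow> memory \<Rightarrow> bool" where
  "preserves k s s' \<longleftrightarrow> (\<forall>x j. x \<in> {''a'', ''b'', ''Z''} \<or> int k < j \<longrightarrow> s' x j = s x j)"

lemma preserves_frame: "preserves k s s' \<Longrightarrow> int k < j \<Longrightarrow> s' x j = s x j"
  by (simp add: preserves_def)

lemma preserves_trans: "preserves k s s' \<Longrightarrow> preserves k s' s'' \<Longrightarrow> preserves k s s''"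
  by (simp add: preserves_def)

lemma preserves_Suc: "preserves k s s' \<Longrightarrow> preserves (Suc k) s s'"
  by (simp add: preserves_def)

lemma preserves_update:
  "x \<notin> {''a'', ''b'', ''Z''} \<Longrightarrow> j \<le> int k \<Longrightarrow> preserves k s (s(x := (s x)(j := e)))"
  by (auto simp: preserves_def)

lemma input_at_preserves: "input_at s a b Z \<Longrightarrow> preserves k s s' \<Longrightarrow> input_at s' a b Z"
  by (simp add: input_at_def preserves_def)

text \<open>Since \<open>v < b\<close>, division by \<open>b\<close> recovers \<open>(u, v)\<close>
  from its address. The loop over \<open>u\<close> also reaches \<open>u = a\<close>, past the
  table; memory is 0 there, in agreement with \<open>(a, v) \<notin> Z\<close>.\<close>

lemma input_at_initial_memory:
  assumes "Z \<subseteq> rect a b" "b \<ge> 1"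
  shows "input_at (initial_memory m n a b Z) a b Z"
proof -
  have "(\<exists>u'<a. \<exists>v'<b. int u * int b + int v = int (u' * b + v') \<and> (u', v') \<in> Z) \<longleftrightarrow>
      (u, v) \<in> Z" if "v < b" for u v
  proof
    assume "\<exists>u'<a. \<exists>v'<b. int u * int b + int v = int (u' * b + v') \<and> (u', v') \<in> Z"
    then obtain u' v' where *: "v' < b" "int u * int b + int v = int (u' * b + v')" "(u', v') \<in> Z"
      by blast
    have "u * b + v = u' * b + v'" using *(2) by (simp flip: of_nat_mult of_nat_add)
    then have "(u * b + v) div b = (u' * b + v') div b" "(u * b + v) mod b = (u' * b + v') mod b"
      by auto
    then show "(u, v) \<in> Z" using * that by simp
  next
    assume "(u, v) \<in> Z"
    then show "\<exists>u'<a. \<exists>v'<b. int u * int b + int v = int (u' * b + v') \<and> (u', v') \<in> Z"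
      using assms(1) by (intro exI[of _ u] conjI exI[of _ v]) (auto simp: rect_def)
  qed
  then show ?thesis by (simp add: input_at_def initial_memory_def)
qed

text \<open>The clause on arrays other than \<open>h\<close> and \<open>v\<close> protects the
  caller, which works in the same frame. A round costs 20 for the body and 5 for the test; 11 pays
  for two stores and the last test.\<close>

lemma runs_height_prog:
  assumes "input_at s a b Z" "Z \<subseteq> rect a b" "s ''u'' (int k) = int u" "u \<le> a"
  shows "runs (height_prog k) s (25 * b + 11) (\<lambda>s'. s' ''h'' (int k) = int (height Z u) \<and>
    preserves k s s' \<and> (\<forall>x j. x \<notin> {''h'', ''v''} \<longrightarrow> s' x j = s x j))"
proof -
  let ?h = "\<lambda>i. card {v. v < i \<and> (u, v) \<in> Z}"
  define I where "I i s' \<longleftrightarrow> s' ''h'' (int k) = int (?h i) \<and> s' ''v'' (int k) = int i \<and>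
    preserves k s s' \<and> (\<forall>x j. x \<notin> {''h'', ''v''} \<longrightarrow> s' x j = s x j)" for i s'
  have h_Suc: "?h (Suc i) = ?h i + of_bool ((u, i) \<in> Z)" for i
  proof -
    have "{v. v < Suc i \<and> (u, v) \<in> Z} =
        (if (u, i) \<in> Z then insert i {v. v < i \<and> (u, v) \<in> Z} else {v. v < i \<and> (u, v) \<in> Z})"
      by (auto simp: less_Suc_eq)
    then show ?thesis by simp
  qed
  have "{v. v < b \<and> (u, v) \<in> Z} = {v. (u, v) \<in> Z}"
    using assms(2) by (auto simp: rect_def)
  then have h_b: "?h b = height Z u" by (simp add: height_def)
  let ?test = "Less (slot ''v'' k) (slot ''b'' 0)"
  let ?body = "Seq (store ''h'' k (Add (slot ''h'' k)
        (Read ''Z'' (Add (Mul (slot ''u'' k) (slot ''b'' 0)) (slot ''v'' k)))))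
      (store ''v'' k (Add (slot ''v'' k) (Const 1)))"
  have loop: "eval_test ?test s' \<and> runs ?body s' 20 (I (Suc i))" if "i < b" "I i s'" for i s'
  proof
    have inp: "input_at s' a b Z"
      by (rule input_at_preserves[OF assms(1), of k]) (use that(2) in \<open>simp add: I_def\<close>)
    have u: "s' ''u'' (int k) = int u" using that(2) assms(3) unfolding I_def by simp
    show "eval_test ?test s'" using that inp unfolding I_def input_at_def by simp
    show "runs ?body s' 20 (I (Suc i))"
      by (rule runs_weaken[OF runs_Assign_Seq[OF refl refl runs_Assign[where Q = "I (Suc i)"]]])
        (use that inp u assms(4) in \<open>auto simp: I_def h_Suc input_at_def preserves_def\<close>)
  qed
  have stop: "\<not> eval_test ?test s'" if "I b s'" for s'
    using input_at_preserves[OF assms(1), of k s'] that unfolding I_def input_at_def by simp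
  let ?s0 = "s(''h'' := (s ''h'')(int k := 0))"
  let ?s1 = "?s0(''v'' := (?s0 ''v'')(int k := 0))"
  have start: "I 0 ?s1" by (simp add: I_def preserves_def)
  have iter: "runs (While ?test ?body) ?s1 (b * (test_cost ?test + 20) + test_cost ?test) (I b)"
    by (rule runs_While[of I, OF start loop stop])
  have "runs (Seq (store ''v'' k (Const 0)) (While ?test ?body)) ?s0 (25 * b + 8) (I b)"
    by (rule runs_weaken[OF runs_Assign_Seq[OF _ _ iter]]) simp_all
  then have "runs (height_prog k) s (25 * b + 11) (I b)"
    unfolding height_prog_def by (rule runs_weaken[OF runs_Assign_Seq[rotated 2]]) simp_all
  then show ?thesis
    by (rule runs_weaken) (simp_all add: I_def h_b)
qed

section \<open>Correctness and running time of the unrolled recursion\<close>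

definition computes_cost :: "prog \<Rightarrow> nat \<Rightarrow> nat \<Rightarrow> nat \<Rightarrow> nat \<Rightarrow> (nat \<times> nat) set \<Rightarrow> bool" where
  "computes_cost c T k a b Z \<longleftrightarrow> (\<forall>s p q. input_at s a b Z \<longrightarrow> s ''p'' (int k) = int p \<longrightarrow>
    s ''q'' (int k) = int q \<longrightarrow>
    runs c s T (\<lambda>s'. s' ''r'' (int k) = int (cost (height Z) a k p q) \<and> preserves k s s'))"

lemma runs_call:
  assumes "computes_cost c T k a b Z" "input_at s a b Z"
    and "y \<noteq> ''p''" and x: "s x (int (Suc k)) = int p" and y: "s y (int (Suc k)) = int q"
  shows "runs (call c k x y) s (T + 8)
    (\<lambda>s'. s' ''r'' (int k) = int (cost (height Z) a k p q) \<and> preserves k s s')"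
proof -
  let ?s0 = "s(''p'' := (s ''p'')(int k := int p))"
  let ?s1 = "?s0(''q'' := (?s0 ''q'')(int k := int q))"
  have pres: "preserves k s ?s1" by (auto simp: preserves_def)
  have "runs c ?s1 T (\<lambda>s'. s' ''r'' (int k) = int (cost (height Z) a k p q) \<and> preserves k ?s1 s')"
    using assms(1) input_at_preserves[OF assms(2) pres] unfolding computes_cost_def by simp
  then have "runs c ?s1 T (\<lambda>s'. s' ''r'' (int k) = int (cost (height Z) a k p q) \<and> preserves k s s')"
    by (rule runs_weaken) (use preserves_trans[OF pres] in auto)
  note run = this
  show ?thesis
    unfolding call_def
    by (rule runs_weaken[OF runs_Assign_Seq[OF _ _ runs_Assign_Seq[OF _ _ run]]])
      (use assms(3) x y in simp_all)
qed

lemma runs_loop_body: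
  assumes c: "computes_cost c T k a b Z" and inp: "input_at s a b Z" and Z: "Z \<subseteq> rect a b"
    and s: "s ''u'' (int (Suc k)) = int u" "s ''p'' (int (Suc k)) = int p"
      "s ''q'' (int (Suc k)) = int q" "s ''r'' (int (Suc k)) = int r"
    and u: "u \<le> a"
  shows "runs (loop_body c k) s (2 * T + 25 * b + 52) (\<lambda>s'. s' ''u'' (int (Suc k)) = int (Suc u) \<and>
    s' ''p'' (int (Suc k)) = int p \<and> s' ''q'' (int (Suc k)) = int q \<and>
    s' ''r'' (int (Suc k)) =
      int (min (cost (height Z) a k u q + cost (height Z) a k p (height Z u)) r) \<and>
    preserves (Suc k) s s')" (is "runs _ _ _ ?Q")
proof -
  let ?K = "int (Suc k)" and ?c1 = "cost (height Z) a k u q"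
    and ?c2 = "cost (height Z) a k p (height Z u)"
  let ?b = "Branch (Less (Add (slot ''t'' (Suc k)) (slot ''r'' k)) (slot ''r'' (Suc k)))
      (store ''r'' (Suc k) (Add (slot ''t'' (Suc k)) (slot ''r'' k))) Skip"
  let ?rest3 = "Seq ?b (store ''u'' (Suc k) (Add (slot ''u'' (Suc k)) (Const 1)))"
  let ?rest2 = "Seq (call c k ''p'' ''h'') ?rest3"
  let ?rest1 = "Seq (store ''t'' (Suc k) (slot ''r'' k)) (Seq (height_prog (Suc k)) ?rest2)"
  have "runs (Seq (call c k ''u'' ''q'') ?rest1) s
      (T + 8 + (4 + (25 * b + 11 + (T + 8 + (15 + 6))))) ?Q"
  proof (rule runs_Seq[OF runs_call[OF c inp _ s(1) s(3)]], simp, elim conjE)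
    fix s1 assume r1: "s1 ''r'' (int k) = int ?c1" and pres1: "preserves k s s1"
    let ?s2 = "s1(''t'' := (s1 ''t'')(?K := int ?c1))"
    have pres2: "preserves (Suc k) s ?s2"
      using preserves_Suc[OF pres1] by (auto simp: preserves_def)
    have frame1: "s1 x ?K = s x ?K" for x
      by (rule preserves_frame[OF pres1]) simp
    have "runs (Seq (height_prog (Suc k)) ?rest2) ?s2
        (25 * b + 11 + (T + 8 + (15 + 6))) ?Q"
    proof (rule runs_Seq[OF runs_height_prog[OF input_at_preserves[OF inp pres2] Z _ u]], goal_cases)
      case 1
      then show ?case using s(1) frame1 by simp
    next
      case (2 s3)
      then have h: "s3 ''h'' ?K = int (height Z u)" and pres23: "preserves (Suc k) ?s2 s3"
        and others: "\<And>x j. x \<notin> {''h'', ''v''} \<Longrightarrow> s3 x j = ?s2 x j"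
        by auto
      have pres3: "preserves (Suc k) s s3" by (rule preserves_trans[OF pres2 pres23])
      have s3: "s3 ''u'' ?K = int u" "s3 ''p'' ?K = int p" "s3 ''q'' ?K = int q"
        "s3 ''r'' ?K = int r" "s3 ''t'' ?K = int ?c1"
        using s frame1 by (simp_all add: others)
      show ?case
      proof (rule runs_Seq[OF runs_call[OF c input_at_preserves[OF inp pres3] _ s3(2) h]], simp, elim conjE)
        fix s4 assume r4: "s4 ''r'' (int k) = int ?c2" and pres34: "preserves k s3 s4"
        have pres4: "preserves (Suc k) s s4"
          by (rule preserves_trans[OF pres3 preserves_Suc[OF pres34]])
        have "s4 x ?K = s3 x ?K" for x
          by (rule preserves_frame[OF pres34]) simp
        then have s4: "s4 ''u'' ?K = int u" "s4 ''p'' ?K = int p" "s4 ''q'' ?K = int q"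
          "s4 ''r'' ?K = int r" "s4 ''t'' ?K = int ?c1"
          using s3 by simp_all
        \<comment> \<open>This describes both branches: if the new sum is not smaller, storing the
          minimum rewrites the old \<open>r\<close>.\<close>
        let ?s5 = "s4(''r'' := (s4 ''r'')(?K := int (min (?c1 + ?c2) r)))"
        have "runs ?b s4 (8 + 7) (\<lambda>s'. s' = ?s5)"
          by (rule runs_weaken[OF runs_Branch[where Q = "\<lambda>s'. s' = ?s5" and T = 7]])
            (auto intro!: runs_weaken[OF runs_Assign[where Q = "\<lambda>s'. s' = ?s5"]]
              runs_weaken[OF runs_Skip[where Q = "\<lambda>s'. s' = ?s5"]]
              simp: s4[simplified] r4 fun_upd_idem)
        then have b: "runs ?b s4 15 (\<lambda>s'. s' = ?s5)" by simp
        show "runs ?rest3 s4 (15 + 6) ?Q"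
          by (rule runs_Seq[OF b], rule runs_weaken[OF runs_Assign[where Q = ?Q]])
            (use s4 pres4 in \<open>auto simp: preserves_def\<close>)
      qed
    qed
    then show "runs ?rest1 s1 (4 + (25 * b + 11 + (T + 8 + (15 + 6)))) ?Q"
      by (intro runs_weaken[OF runs_Assign_Seq[where i = ?K and w = "int ?c1"]]) (auto simp: r1)
  qed
  then show ?thesis
    unfolding loop_body_def by (rule runs_weaken) auto
qed

text \<open>The 20 pays for passing arguments to the first call, two stores and the last loop test;
  57 is 52 for the body plus 5 for the test.\<close>

primrec cost_time :: "nat \<Rightarrow> nat \<Rightarrow> nat \<Rightarrow> nat" where
  "cost_time a b 0 = 7"
| "cost_time a b (Suc k) =
    cost_time a b k + 20 + Suc a * (2 * cost_time a b k + 25 * b + 57)"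

lemma computes_cost_cost_prog:
  assumes Z: "Z \<subseteq> rect a b"
  shows "computes_cost (cost_prog k) (cost_time a b k) k a b Z"
proof (induction k)
  case 0
  show ?case
    unfolding computes_cost_def
  proof (intro allI impI)
    fix s p q
    assume "s ''p'' (int 0) = int p" "s ''q'' (int 0) = int q"
    then show "runs (cost_prog 0) s (cost_time a b 0)
        (\<lambda>s'. s' ''r'' (int 0) = int (cost (height Z) a 0 p q) \<and> preserves 0 s s')"
      unfolding cost_prog.simps
      by (intro runs_weaken[OF runs_Assign[where Q = "\<lambda>s'. s' ''r'' (int 0) =
            int (cost (height Z) a 0 p q) \<and> preserves 0 s s'"]])
        (auto simp: preserves_def)
  qed
next
  case (Suc k)
  let ?c = "cost (height Z) a k" and ?K = "int (Suc k)" and ?T = "cost_time a b k"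
  show ?case
    unfolding computes_cost_def
  proof (intro allI impI)
    fix s p q
    assume inp: "input_at s a b Z" and s: "s ''p'' ?K = int p" "s ''q'' ?K = int q"
    \<comment> \<open>After \<open>Suc a\<close> rounds this is the defining expression of
      \<open>cost\<close> at \<open>Suc k\<close>.\<close>
    let ?best = "\<lambda>i. Min (insert (?c p q) ((\<lambda>u. ?c u q + ?c p (height Z u)) ` {..<i}))"
    define I where "I i s' \<longleftrightarrow> s' ''u'' ?K = int i \<and> s' ''p'' ?K = int p \<and> s' ''q'' ?K = int q \<and>
      s' ''r'' ?K = int (?best i) \<and> preserves (Suc k) s s'" for i s'
    let ?test = "LessEq (slot ''u'' (Suc k)) (slot ''a'' 0)"
    have best_Suc: "?best (Suc i) = min (?c i q + ?c p (height Z i)) (?best i)" for i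
      unfolding lessThan_Suc image_insert by (subst insert_commute) (rule Min_insert; simp)
    have inp': "input_at s' a b Z" if "I i s'" for i s'
      by (rule input_at_preserves[OF inp, of "Suc k"]) (use that in \<open>simp add: I_def\<close>)
    have loop: "eval_test ?test s' \<and> runs (loop_body (cost_prog k) k) s' (2 * ?T + 25 * b + 52) (I (Suc i))"
      if i: "i < Suc a" and I: "I i s'" for i s'
    proof
      note I' = I[unfolded I_def]
      show "eval_test ?test s'" using I' inp'[OF I] i by (simp add: input_at_def)
      have "runs (loop_body (cost_prog k) k) s' (2 * ?T + 25 * b + 52) (\<lambda>s''.
          s'' ''u'' ?K = int (Suc i) \<and> s'' ''p'' ?K = int p \<and> s'' ''q'' ?K = int q \<and>
          s'' ''r'' ?K = int (min (?c i q + ?c p (height Z i)) (?best i)) \<and>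
          preserves (Suc k) s' s'')"
        by (rule runs_loop_body[OF Suc.IH inp'[OF I] Z]) (use I' i in auto)
      then show "runs (loop_body (cost_prog k) k) s' (2 * ?T + 25 * b + 52) (I (Suc i))"
        by (rule runs_weaken) (use I' preserves_trans in \<open>auto simp: I_def best_Suc\<close>)
    qed
    have stop: "\<not> eval_test ?test s'" if "I (Suc a) s'" for s'
      using inp'[OF that] that by (simp add: input_at_def I_def)
    let ?rest = "Seq (store ''r'' (Suc k) (slot ''r'' k)) (Seq (store ''u'' (Suc k) (Const 0))
      (While ?test (loop_body (cost_prog k) k)))"
    have "runs (Seq (call (cost_prog k) k ''p'' ''q'') ?rest) s
        (?T + 8 + (7 + (Suc a * (2 * ?T + 25 * b + 57) + 5))) (I (Suc a))"
    proof (rule runs_Seq[OF runs_call[OF Suc.IH inp _ s]], simp, elim conjE)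
      fix s1 assume r1: "s1 ''r'' (int k) = int (?c p q)" and pres1: "preserves k s s1"
      let ?s2 = "s1(''r'' := (s1 ''r'')(?K := int (?c p q)))"
      let ?s3 = "?s2(''u'' := (?s2 ''u'')(?K := 0))"
      have frame: "s1 x ?K = s x ?K" for x
        by (rule preserves_frame[OF pres1]) simp
      have start: "I 0 ?s3"
        using s frame preserves_Suc[OF pres1] by (auto simp: I_def preserves_def)
      have "runs (Seq (store ''u'' (Suc k) (Const 0)) (While ?test (loop_body (cost_prog k) k))) ?s2
          (Suc a * (2 * ?T + 25 * b + 57) + 8) (I (Suc a))"
        by (rule runs_weaken[OF runs_Assign_Seq[OF _ _ runs_While[of I, OF start loop stop]]]) simp_all
      then show "runs ?rest s1 (7 + (Suc a * (2 * ?T + 25 * b + 57) + 5)) (I (Suc a))"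
        by (rule runs_weaken[OF runs_Assign_Seq[rotated 2]]) (simp_all add: r1)
    qed
    then show "runs (cost_prog (Suc k)) s (cost_time a b (Suc k))
        (\<lambda>s'. s' ''r'' ?K = int (cost (height Z) a (Suc k) p q) \<and> preserves (Suc k) s s')"
      unfolding cost_prog.simps cost.simps
      by (rule runs_weaken) (simp_all add: I_def)
  qed
qed

section \<open>The polynomial time bound and the final program\<close>

primrec time_poly :: "nat \<Rightarrow> nat poly" where
  "time_poly 0 = [:7:]"
| "time_poly (Suc k) = time_poly k + [:20:] + [:1, 1:] * (2 * time_poly k + [:57, 25:])"

text \<open>\<open>time_poly\<close> repeats the recursion of \<open>cost_time\<close> with
  \<open>a\<close> and \<open>b\<close> both replaced by the variable. As both are at least 1, each
  is at most \<open>a * b\<close>, and the recursion is monotone.\<close>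

lemma cost_time_le_poly:
  assumes "a \<ge> 1" "b \<ge> 1"
  shows "cost_time a b k \<le> poly (time_poly k) (a * b)"
proof (induction k)
  case (Suc k)
  have ab: "a \<le> a * b" "b \<le> a * b" using assms by simp_all
  have "Suc a * (2 * cost_time a b k + 25 * b + 57) \<le>
      Suc (a * b) * (2 * poly (time_poly k) (a * b) + 25 * (a * b) + 57)"
    by (intro mult_mono add_mono Suc_le_mono[THEN iffD2] ab Suc.IH mult_left_mono) auto
  with Suc.IH show ?case by (simp add: algebra_simps)
qed simp

text \<open>\<open>rect n m\<close> has \<open>n\<close> columns and \<open>m\<close> rows, so
  \<open>n\<close> goes to \<open>p\<close> and \<open>m\<close> to \<open>q\<close>.\<close>

definition approx_prog :: "nat \<Rightarrow> prog" where
  "approx_prog L = Seq (store ''p'' L (slot ''n'' 0)) (Seq (store ''q'' L (slot ''m'' 0))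
    (Seq (cost_prog L) (store ''out'' 0 (slot ''r'' L))))"

lemma runs_approx_prog:
  assumes "Z \<subseteq> rect a b" "b \<ge> 1"
  shows "runs (approx_prog L) (initial_memory m n a b Z) (cost_time a b L + 12)
    (\<lambda>s. returned s = int (cost (height Z) a L n m))"
proof -
  let ?s0 = "initial_memory m n a b Z"
  let ?s1 = "?s0(''p'' := (?s0 ''p'')(int L := int n))"
  let ?s2 = "?s1(''q'' := (?s1 ''q'')(int L := int m))"
  have "preserves L ?s0 ?s1" "preserves L ?s1 ?s2"
    by (rule preserves_update; simp)+
  then have "input_at ?s2 a b Z"
    using input_at_preserves[OF input_at_initial_memory[OF assms]] preserves_trans by blast
  then have "runs (cost_prog L) ?s2 (cost_time a b L)
      (\<lambda>s. s ''r'' (int L) = int (cost (height Z) a L n m) \<and> preserves L ?s2 s)"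
    using computes_cost_cost_prog[OF assms(1), of L] unfolding computes_cost_def by simp
  then have "runs (Seq (cost_prog L) (store ''out'' 0 (slot ''r'' L))) ?s2 (cost_time a b L + 4)
      (\<lambda>s. returned s = int (cost (height Z) a L n m))"
    by (rule runs_Seq)
      (rule runs_weaken[OF runs_Assign[where Q = "\<lambda>s. returned s = int (cost (height Z) a L n m)"]],
        auto simp: returned_def)
  note run = this
  show ?thesis
    unfolding approx_prog_def
    by (rule runs_weaken[OF runs_Assign_Seq[OF _ _ runs_Assign_Seq[OF _ _ run]]])
      (simp_all add: initial_memory_def)
qed

theorem theorem1p5:
  fixes L :: nat
  shows "\<exists>(C::real) (alg::prog) (time::nat poly). C \<ge> 1 \<and>
    (\<forall>m n a b :: nat. \<forall>Z :: (nat \<times> nat) set.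
       m \<ge> 1 \<and> n \<ge> 1 \<and> a \<ge> 1 \<and> b \<ge> 1 \<and> zero_set Z \<and> Z \<subseteq> rect a b \<and> rect a b \<subseteq> rect n m \<longrightarrow>
       (\<exists>t s. exec alg (initial_memory m n a b Z) t s \<and>
          t \<le> poly time (a * b) \<and>
          real (gamma L Z m n) \<le> real_of_int (returned s) \<and>
          real_of_int (returned s) \<le> C * real (gamma L Z m n)))"
proof (intro exI[of _ "4 ^ L :: real"] exI[of _ "approx_prog L"]
    exI[of _ "time_poly L + [:12:]"] conjI allI impI)
  show "(4::real) ^ L \<ge> 1" by simp
  fix m n a b :: nat and Z :: "(nat \<times> nat) set"
  assume asm: "m \<ge> 1 \<and> n \<ge> 1 \<and> a \<ge> 1 \<and> b \<ge> 1 \<and> zero_set Z \<and> Z \<subseteq> rect a b \<and> rect a b \<subseteq> rect n m"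
  then have ab: "a \<ge> 1" "b \<ge> 1" and Z: "zero_set Z" "Z \<subseteq> rect a b" by auto
  \<comment> \<open>The far corner turns the inclusion of rectangles into \<open>a \<le> n\<close>
    and \<open>b \<le> m\<close>; it exists since both sides are positive.\<close>
  have "(a - 1, b - 1) \<in> rect a b" using ab by (simp add: rect_def)
  then have "(a - 1, b - 1) \<in> rect n m" using asm by blast
  then have le: "a \<le> n" "b \<le> m" by (auto simp: rect_def)
  obtain t s where ts: "exec (approx_prog L) (initial_memory m n a b Z) t s"
    "t \<le> cost_time a b L + 12" "returned s = int (cost (height Z) a L n m)"
    using runs_approx_prog[OF Z(2) ab(2)] unfolding runs_def by blast
  have "t \<le> poly (time_poly L + [:12:]) (a * b)"
    using ts(2) cost_time_le_poly[OF ab, of L] by simp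
  moreover have "real (gamma L Z m n) \<le> real_of_int (returned s)"
    using gamma_le_cost[OF Z le] ts(3) by simp
  moreover have "real_of_int (returned s) \<le> 4 ^ L * real (gamma L Z m n)"
    using of_nat_mono[OF cost_le_gamma[OF Z, of L n m], where 'a = real] ts(3) by simp
  ultimately show "\<exists>t s. exec (approx_prog L) (initial_memory m n a b Z) t s \<and>
      t \<le> poly (time_poly L + [:12:]) (a * b) \<and>
      real (gamma L Z m n) \<le> real_of_int (returned s) \<and>
      real_of_int (returned s) \<le> 4 ^ L * real (gamma L Z m n)"
    using ts(1) by blast
qed

end
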